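(* For every subgroup $K\le\mathbb Q/\mathbb Z$ there is an embedding (injective group homomorphism) $\mathrm{PL}_+(I)\wr_r K\hookrightarrow\mathrm{PL}_+(S^1)$.
   Context: $\mathrm{PL}_+(I)$ and $\mathrm{PL}_+(S^1)$ are the groups of orientation-preserving piecewise-linear homeomorphisms (with finitely many breakpoints) of the unit interval $I=[0,1]$ and of the circle $S^1=\mathbb R/\mathbb Z$. For groups $C,T$, $C\wr_r T\cong\left(\bigoplus_{t\in T}C\right)\rtimes T$ denotes the restricted standard wreath product. *)

theory Defs
  imports
    "HOL-Analysis.Analysis"
    "HOL-Algebra.Coset"
    "HOL-Algebra.Product_Groups"
    "HOL-Algebra.Bij"
begin

section \<open>The circle\<close>

quotient_type circle = real / "\<lambda>x y :: real. x - y \<in> \<int>"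
  morphisms rep_circle to_circle
proof (rule equivpI)
  show "reflp (\<lambda>x y :: real. x - y \<in> \<int>)"
    by (simp add: reflp_def)
  show "symp (\<lambda>x y :: real. x - y \<in> \<int>)"
    by (rule sympI) (metis Ints_minus minus_diff_eq)
  show "transp (\<lambda>x y :: real. x - y \<in> \<int>)"
    by (rule transpI) (metis Ints_add add_diff_eq diff_add_cancel)
qed

text \<open>The topology is the quotient topology.\<close>

instantiation circle :: topological_space
begin

definition open_circle :: "circle set \<Rightarrow> bool"
  where "open_circle U \<longleftrightarrow> open (to_circle -` U)"

instance
  by standard (auto simp: open_circle_def vimage_Int vimage_Union)

end


section \<open>Piecewise linear homeomorphisms\<close>

definition piecewise_linear :: "real set \<Rightarrow> real set \<Rightarrow> (real \<Rightarrow> real) \<Rightarrow> bool"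
  \<comment> \<open>\<open>f\<close> is affine on every compact interval of \<open>S\<close> with no point of \<open>B\<close> in its interior\<close>
  where "piecewise_linear S B f \<longleftrightarrow>
    (\<forall>x y. x < y \<and> {x..y} \<subseteq> S \<and> {x<..<y} \<inter> B = {} \<longrightarrow>
      (\<exists>m c. \<forall>t\<in>{x..y}. f t = m * t + c))"

definition PL_interval :: "(real \<Rightarrow> real) monoid"
  where "PL_interval = (BijGroup {0..1})
    \<lparr>carrier := {f \<in> Bij {0..1}.
       (\<exists>g. homeomorphism {0..1} {0..1} f g) \<and>
       strict_mono_on {0..1} f \<and>
       (\<exists>B. finite B \<and> piecewise_linear {0..1} B f)}\<rparr>"

definition circle_lift :: "(real \<Rightarrow> real) \<Rightarrow> (circle \<Rightarrow> circle) \<Rightarrow> bool"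
  where "circle_lift F f \<longleftrightarrow>
    continuous_on UNIV F \<and> (\<forall>x. to_circle (F x) = f (to_circle x))"

text \<open>
  Orientation and piecewise linearity of a circle homeomorphism are read off from a lift to the
  real line. Any two lifts differ by an integer constant, so the choice of lift is immaterial.
\<close>

definition orientation_preserving :: "(circle \<Rightarrow> circle) \<Rightarrow> bool"
  where "orientation_preserving f \<longleftrightarrow> (\<exists>F. circle_lift F f \<and> strict_mono F)"

definition piecewise_linear_circle :: "(circle \<Rightarrow> circle) \<Rightarrow> bool"
  \<comment> \<open>the finitely many breakpoints \<open>B\<close> lie on the circle; those of the lift are their preimages\<close>
  where "piecewise_linear_circle f \<longleftrightarrow>
    (\<exists>F B. circle_lift F f \<and> finite B \<and> piecewise_linear UNIV (to_circle -` B) F)"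

definition PL_circle :: "(circle \<Rightarrow> circle) monoid"
  where "PL_circle = (BijGroup UNIV)
    \<lparr>carrier := {f \<in> Bij UNIV.
       (\<exists>g. homeomorphism UNIV UNIV f g) \<and>
       orientation_preserving f \<and>
       piecewise_linear_circle f}\<rparr>"


section \<open>Restricted wreath products\<close>

definition semidirect_product ::
    "('n, 'x) monoid_scheme \<Rightarrow> ('h, 'y) monoid_scheme \<Rightarrow> ('h \<Rightarrow> 'n \<Rightarrow> 'n) \<Rightarrow> ('n \<times> 'h) monoid"
  where "semidirect_product N H \<phi> =
    \<lparr>carrier = carrier N \<times> carrier H,
     monoid.mult = (\<lambda>(n, h) (n', h'). (n \<otimes>\<^bsub>N\<^esub> \<phi> h n', h \<otimes>\<^bsub>H\<^esub> h')),
     one = (\<one>\<^bsub>N\<^esub>, \<one>\<^bsub>H\<^esub>)\<rparr>"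

definition restricted_wreath_product ::
    "('c, 'x) monoid_scheme \<Rightarrow> ('t, 'y) monoid_scheme \<Rightarrow> (('t \<Rightarrow> 'c) \<times> 't) monoid"
  \<comment> \<open>\<open>T\<close> permutes the summands by left translation: \<open>t\<close> moves the summand at \<open>s\<close> to \<open>t s\<close>\<close>
  where "restricted_wreath_product C T =
    semidirect_product (sum_group (carrier T) (\<lambda>_. C)) T
      (\<lambda>t a. \<lambda>s\<in>carrier T. a (inv\<^bsub>T\<^esub> t \<otimes>\<^bsub>T\<^esub> s))"


section \<open>The group of rationals modulo integers\<close>

definition rat_mod_int :: "rat set monoid"
  where "rat_mod_int = \<lparr>carrier = UNIV, monoid.mult = (+), one = 0\<rparr> Mod \<int>"

end

theory Submission
  imports Defs
begin

text \<open>
  If \<open>K\<close> is infinite, rotations have dense orbits and leave no room for the summands, so the rotation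
  action of the rationals is blown up. Let \<open>S\<^sub>m\<close> be the piecewise linear map of the line with
  \<open>S\<^sub>m(x + 1) = S\<^sub>m(x) + m\<close> that is the identity on \<open>[0, 1/2]\<close> and has slope \<open>2m - 1\<close> on \<open>[1/2, 1]\<close>, and
  put \<open>R\<^sub>n = S\<^sub>n \<circ> \<dots> \<circ> S\<^sub>1\<close>. Let \<open>k/n!\<close> act as the conjugate by \<open>R\<^sub>n\<close> of the translation by \<open>k\<close>. Because
  \<open>S\<^sub>n\<^sub>+\<^sub>1\<close> turns a translation by \<open>k\<close> into one by \<open>(n + 1) k\<close>, this does not depend on the representation
  of the fraction, and it is an action of the rationals in which integers act by translation. As every
  \<open>R\<^sub>n\<close> fixes \<open>[0, 1/2]\<close> pointwise, the translates of \<open>(0, 1/2)\<close> are pairwise disjoint. On the circle,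
  put a copy of \<open>PL\<^sub>+(I)\<close> on each translate of this interval by an element of \<open>K\<close>.
\<close>

section \<open>Wreath products of permutation groups\<close>

text \<open>\<open>wandering\<close> makes the translates of \<open>J\<close> pairwise disjoint, so
  the conjugates of the \<open>C\<close>-action by different \<open>\<sigma> t\<close> have disjoint
  supports and commute, as a direct sum requires. With \<open>J\<close> nonempty it also forces
  \<open>\<sigma>\<close> to be faithful.\<close>

locale wreath_action =
  fixes C :: "('c, 'm) monoid_scheme" and T :: "('t, 'n) monoid_scheme"
    and \<iota> :: "'c \<Rightarrow> 'x \<Rightarrow> 'x" and \<sigma> :: "'t \<Rightarrow> 'x \<Rightarrow> 'x" and J :: "'x set"
  assumes group_C: "group C" and group_T: "group T"
    and \<iota>_mult: "\<lbrakk>c \<in> carrier C; d \<in> carrier C\<rbrakk> \<Longrightarrow> \<iota> (c \<otimes>\<^bsub>C\<^esub> d) = \<iota> c \<circ> \<iota> d"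
    and \<iota>_one: "\<iota> \<one>\<^bsub>C\<^esub> = id"
    and \<iota>_inj: "inj_on \<iota> (carrier C)"
    and \<iota>_support: "\<lbrakk>c \<in> carrier C; x \<notin> J\<rbrakk> \<Longrightarrow> \<iota> c x = x"
    and \<sigma>_mult: "\<lbrakk>s \<in> carrier T; t \<in> carrier T\<rbrakk> \<Longrightarrow> \<sigma> (s \<otimes>\<^bsub>T\<^esub> t) = \<sigma> s \<circ> \<sigma> t"
    and \<sigma>_one: "\<sigma> \<one>\<^bsub>T\<^esub> = id"
    and J_nonempty: "J \<noteq> {}"
    and wandering: "\<lbrakk>t \<in> carrier T; x \<in> J; \<sigma> t x \<in> J\<rbrakk> \<Longrightarrow> t = \<one>\<^bsub>T\<^esub>"
begin

sublocale T: group T by (rule group_T)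
sublocale C: group C by (rule group_C)

lemma \<sigma>_inv:
  assumes "t \<in> carrier T"
  shows "\<sigma> (inv\<^bsub>T\<^esub> t) (\<sigma> t x) = x" "\<sigma> t (\<sigma> (inv\<^bsub>T\<^esub> t) x) = x"
  using assms \<sigma>_mult[of "inv\<^bsub>T\<^esub> t" t] \<sigma>_mult[of t "inv\<^bsub>T\<^esub> t"]
  by (simp_all add: \<sigma>_one fun_eq_iff)

lemma \<sigma>_eq_iff:
  assumes "t \<in> carrier T"
  shows "\<sigma> t x = \<sigma> t y \<longleftrightarrow> x = y"
  by (metis \<sigma>_inv(1) assms)

lemma translates_disjoint:
  assumes "s \<in> carrier T" "t \<in> carrier T" "x \<in> J" "y \<in> J" "\<sigma> s x = \<sigma> t y"
  shows "s = t" "x = y"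
proof -
  have "\<sigma> (inv\<^bsub>T\<^esub> t \<otimes>\<^bsub>T\<^esub> s) x = y"
    using assms by (simp add: \<sigma>_mult \<sigma>_inv)
  then have "inv\<^bsub>T\<^esub> t \<otimes>\<^bsub>T\<^esub> s = \<one>\<^bsub>T\<^esub>"
    using assms by (intro wandering[of _ x]) auto
  then show "s = t"
    using assms by (metis T.inv_equality T.inv_inv T.inv_closed)
  then show "x = y"
    using assms by (simp add: \<sigma>_eq_iff)
qed

text \<open>The inverse of \<open>c\<close> also acts trivially off \<open>J\<close>, so a point
  that left \<open>J\<close> could not be brought back by it.\<close>

lemma \<iota>_maps_J:
  assumes "c \<in> carrier C" "x \<in> J"
  shows "\<iota> c x \<in> J"
proof (rule ccontr)
  assume "\<iota> c x \<notin> J"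
  then have "\<iota> (inv\<^bsub>C\<^esub> c) (\<iota> c x) = \<iota> c x"
    using assms by (intro \<iota>_support) auto
  moreover have "\<iota> (inv\<^bsub>C\<^esub> c) (\<iota> c x) = x"
    using assms \<iota>_mult[of "inv\<^bsub>C\<^esub> c" c] by (simp add: \<iota>_one fun_eq_iff)
  ultimately show False
    using assms \<open>\<iota> c x \<notin> J\<close> by simp
qed

text \<open>The coordinate at \<open>t\<close> acts on the translate of \<open>J\<close> by
  \<open>t\<close>, through conjugation with \<open>\<sigma> t\<close>;
  \<open>translates_disjoint\<close> makes the \<open>THE\<close> well defined. Defined pointwise,
  this needs no order of factors and makes sense for families of infinite support as well.\<close>

definition base_action :: "('t \<Rightarrow> 'c) \<Rightarrow> 'x \<Rightarrow> 'x" where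
  "base_action a x =
    (if \<exists>t\<in>carrier T. x \<in> \<sigma> t ` J
     then let t = THE t. t \<in> carrier T \<and> x \<in> \<sigma> t ` J in \<sigma> t (\<iota> (a t) (\<sigma> (inv\<^bsub>T\<^esub> t) x))
     else x)"

lemma base_action_translate:
  assumes "t \<in> carrier T" "x \<in> J"
  shows "base_action a (\<sigma> t x) = \<sigma> t (\<iota> (a t) x)"
proof -
  have "(THE s. s \<in> carrier T \<and> \<sigma> t x \<in> \<sigma> s ` J) = t"
    using assms translates_disjoint by (intro the_equality) auto
  with assms show ?thesis
    by (auto simp: base_action_def Let_def \<sigma>_inv)
qed

lemma base_action_outside:
  assumes "\<And>t. t \<in> carrier T \<Longrightarrow> x \<notin> \<sigma> t ` J"
  shows "base_action a x = x"
  using assms by (auto simp: base_action_def)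

lemma translate_cases:
  obtains (inside) t y where "t \<in> carrier T" "y \<in> J" "x = \<sigma> t y"
  | (outside) "\<And>t. t \<in> carrier T \<Longrightarrow> x \<notin> \<sigma> t ` J"
  by blast

lemma base_action_mult:
  assumes "a \<in> carrier T \<rightarrow> carrier C" "b \<in> carrier T \<rightarrow> carrier C"
  shows "base_action (\<lambda>t\<in>carrier T. a t \<otimes>\<^bsub>C\<^esub> b t) = base_action a \<circ> base_action b"
proof
  fix x
  show "base_action (\<lambda>t\<in>carrier T. a t \<otimes>\<^bsub>C\<^esub> b t) x = (base_action a \<circ> base_action b) x"
  proof (cases x rule: translate_cases)
    case (inside t y)
    then have "a t \<in> carrier C" "b t \<in> carrier C" "\<iota> (b t) y \<in> J"
      using assms by (auto intro!: \<iota>_maps_J)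
    with inside show ?thesis
      by (simp add: base_action_translate \<iota>_mult)
  next
    case outside
    then show ?thesis by (simp add: base_action_outside)
  qed
qed

text \<open>\<open>\<sigma> t\<close> carries the translate at \<open>s\<close> to the one at
  \<open>t s\<close>, and the coordinates move along with it. This is the relation that defines the
  semidirect product.\<close>

lemma base_action_conjugate:
  assumes "t \<in> carrier T"
  shows "\<sigma> t \<circ> base_action a =
    base_action (\<lambda>s\<in>carrier T. a (inv\<^bsub>T\<^esub> t \<otimes>\<^bsub>T\<^esub> s)) \<circ> \<sigma> t"
proof
  fix x
  show "(\<sigma> t \<circ> base_action a) x =
    (base_action (\<lambda>s\<in>carrier T. a (inv\<^bsub>T\<^esub> t \<otimes>\<^bsub>T\<^esub> s)) \<circ> \<sigma> t) x"
  proof (cases x rule: translate_cases)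
    case (inside s y)
    have "\<sigma> t x = \<sigma> (t \<otimes>\<^bsub>T\<^esub> s) y"
      using inside assms by (simp add: \<sigma>_mult)
    moreover have "inv\<^bsub>T\<^esub> t \<otimes>\<^bsub>T\<^esub> (t \<otimes>\<^bsub>T\<^esub> s) = s"
      using inside assms by (simp flip: T.m_assoc)
    ultimately show ?thesis
      using inside assms base_action_translate[of "t \<otimes>\<^bsub>T\<^esub> s" y]
      by (simp add: base_action_translate \<sigma>_mult)
  next
    case outside
    have "\<sigma> t x \<notin> \<sigma> s ` J" if s: "s \<in> carrier T" for s
    proof
      assume "\<sigma> t x \<in> \<sigma> s ` J"
      then obtain y where "y \<in> J" "\<sigma> t x = \<sigma> s y" by blast
      then have "x = \<sigma> (inv\<^bsub>T\<^esub> t \<otimes>\<^bsub>T\<^esub> s) y"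
        using assms s \<sigma>_inv(1)[of t x] by (simp add: \<sigma>_mult)
      with \<open>y \<in> J\<close> show False
        using outside[of "inv\<^bsub>T\<^esub> t \<otimes>\<^bsub>T\<^esub> s"] assms s by auto
    qed
    then show ?thesis
      using outside by (simp add: base_action_outside)
  qed
qed

text \<open>A finitely supported family acts as a finite composite of conjugates of maps
  \<open>\<iota> c\<close>. This is where the restriction to the direct sum enters. The induction
  runs over a finite set containing the support, so that one index can be removed at a time.\<close>

lemma base_action_in_closed_set:
  assumes comp: "\<And>f g. f \<in> P \<Longrightarrow> g \<in> P \<Longrightarrow> f \<circ> g \<in> P"
    and \<sigma>: "\<And>t. t \<in> carrier T \<Longrightarrow> \<sigma> t \<in> P"
    and \<iota>: "\<And>c. c \<in> carrier C \<Longrightarrow> \<iota> c \<in> P"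
    and "finite A" "a \<in> carrier T \<rightarrow> carrier C" "{t \<in> carrier T. a t \<noteq> \<one>\<^bsub>C\<^esub>} \<subseteq> A"
  shows "base_action a \<in> P"
  using assms(4-)
proof (induction A arbitrary: a rule: finite_induct)
  case empty
  have "base_action a = id"
  proof
    fix x
    show "base_action a x = id x"
      using empty by (cases x rule: translate_cases)
        (auto simp: base_action_translate base_action_outside \<iota>_one)
  qed
  then show ?case
    using \<sigma>[of "\<one>\<^bsub>T\<^esub>"] by (metis T.one_closed \<sigma>_one)
next
  case (insert s A)
  \<comment> \<open>Erasing the coordinate at \<open>s\<close> leaves a support inside
    \<open>A\<close>; the conjugate of \<open>\<iota> (a s)\<close> by \<open>\<sigma> s\<close>
    then restores the missing factor.\<close>
  define a' where "a' = a(s := \<one>\<^bsub>C\<^esub>)"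
  have a': "a' \<in> carrier T \<rightarrow> carrier C"
    using insert.prems by (auto simp: a'_def)
  have IH: "base_action a' \<in> P"
    using insert.prems by (intro insert.IH a') (auto simp: a'_def)
  show ?case
  proof (cases "s \<in> carrier T")
    case False
    then have "{t \<in> carrier T. a t \<noteq> \<one>\<^bsub>C\<^esub>} \<subseteq> A"
      using insert.prems by auto
    then show ?thesis
      using insert by blast
  next
    case s: True
    have as: "a s \<in> carrier C"
      using s insert.prems by auto
    have "base_action a = (\<sigma> s \<circ> \<iota> (a s) \<circ> \<sigma> (inv\<^bsub>T\<^esub> s)) \<circ> base_action a'"
    proof
      fix x
      \<comment> \<open>The restored factor is supported on the translate at \<open>s\<close>, where
        \<open>base_action a'\<close> is trivial; on every other translate only
        \<open>base_action a'\<close> acts.\<close>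
      have fix_outside: "(\<sigma> s \<circ> \<iota> (a s) \<circ> \<sigma> (inv\<^bsub>T\<^esub> s)) z = z" if "z \<notin> \<sigma> s ` J" for z
      proof -
        have "\<sigma> (inv\<^bsub>T\<^esub> s) z \<notin> J"
          using that s by (metis \<sigma>_inv(2) image_eqI)
        then show ?thesis
          using s as by (simp add: \<iota>_support \<sigma>_inv)
      qed
      show "base_action a x = ((\<sigma> s \<circ> \<iota> (a s) \<circ> \<sigma> (inv\<^bsub>T\<^esub> s)) \<circ> base_action a') x"
      proof (cases x rule: translate_cases)
        case (inside t y)
        show ?thesis
        proof (cases "t = s")
          case True
          with inside show ?thesis
            by (simp add: base_action_translate a'_def \<iota>_one \<sigma>_inv)
        next
          case False
          have "a t \<in> carrier C"
            using inside insert.prems by auto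
          then have "\<iota> (a t) y \<in> J"
            using inside by (intro \<iota>_maps_J) auto
          then have "\<sigma> t (\<iota> (a t) y) \<notin> \<sigma> s ` J"
            using False inside s translates_disjoint by auto
          with False inside show ?thesis
            using fix_outside by (simp add: base_action_translate a'_def)
        qed
      next
        case outside
        then show ?thesis
          using s fix_outside by (simp add: base_action_outside)
      qed
    qed
    moreover have "\<sigma> s \<circ> \<iota> (a s) \<circ> \<sigma> (inv\<^bsub>T\<^esub> s) \<in> P"
      using s as by (intro comp \<sigma> \<iota>) auto
    ultimately show ?thesis
      using IH comp by metis
  qed
qed

section \<open>The action of the wreath product and its faithfulness\<close>

definition wreath_action :: "('t \<Rightarrow> 'c) \<times> 't \<Rightarrow> 'x \<Rightarrow> 'x" where
  "wreath_action = (\<lambda>(a, t). base_action a \<circ> \<sigma> t)"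

lemma carrier_wreath:
  "carrier (restricted_wreath_product C T) =
    {a \<in> carrier T \<rightarrow>\<^sub>E carrier C. finite {t \<in> carrier T. a t \<noteq> \<one>\<^bsub>C\<^esub>}} \<times> carrier T"
  by (simp add: restricted_wreath_product_def semidirect_product_def carrier_sum_group group_C)

lemma wreath_action_mult:
  assumes "x \<in> carrier (restricted_wreath_product C T)"
    "y \<in> carrier (restricted_wreath_product C T)"
  shows "wreath_action (x \<otimes>\<^bsub>restricted_wreath_product C T\<^esub> y) = wreath_action x \<circ> wreath_action y"
proof -
  obtain a s b t where xy: "x = (a, s)" "y = (b, t)"
    by (cases x; cases y)
  define b' where "b' = (\<lambda>r\<in>carrier T. b (inv\<^bsub>T\<^esub> s \<otimes>\<^bsub>T\<^esub> r))"
  have a: "a \<in> carrier T \<rightarrow> carrier C" and b: "b \<in> carrier T \<rightarrow> carrier C"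
    and st: "s \<in> carrier T" "t \<in> carrier T"
    using assms by (auto simp: carrier_wreath xy)
  have b': "b' \<in> carrier T \<rightarrow> carrier C"
    using b st by (auto simp: b'_def)
  have "wreath_action (x \<otimes>\<^bsub>restricted_wreath_product C T\<^esub> y) =
      base_action (\<lambda>r\<in>carrier T. a r \<otimes>\<^bsub>C\<^esub> b' r) \<circ> \<sigma> (s \<otimes>\<^bsub>T\<^esub> t)"
    by (simp add: xy wreath_action_def restricted_wreath_product_def semidirect_product_def b'_def)
  also have "\<dots> = base_action a \<circ> (base_action b' \<circ> \<sigma> s) \<circ> \<sigma> t"
    using a b' st by (simp add: base_action_mult \<sigma>_mult comp_assoc)
  also have "base_action b' \<circ> \<sigma> s = \<sigma> s \<circ> base_action b"
    using st by (simp add: base_action_conjugate b'_def)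
  also have "base_action a \<circ> (\<sigma> s \<circ> base_action b) \<circ> \<sigma> t = wreath_action x \<circ> wreath_action y"
    by (simp add: xy wreath_action_def comp_assoc)
  finally show ?thesis .
qed

text \<open>Base elements preserve every translate of \<open>J\<close>, so the translate into which
  a point of \<open>J\<close> is sent reveals the \<open>T\<close>-component. Cancelling that
  component leaves two base actions, and comparing them on the translate at \<open>r\<close>
  recovers the coordinate at \<open>r\<close>.\<close>

lemma wreath_action_inj: "inj_on wreath_action (carrier (restricted_wreath_product C T))"
proof (rule inj_onI)
  fix x y
  assume xy: "x \<in> carrier (restricted_wreath_product C T)"
    "y \<in> carrier (restricted_wreath_product C T)" and eq: "wreath_action x = wreath_action y"
  obtain a s b t where [simp]: "x = (a, s)" "y = (b, t)"
    by (cases x; cases y)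
  have a: "a \<in> carrier T \<rightarrow>\<^sub>E carrier C" and b: "b \<in> carrier T \<rightarrow>\<^sub>E carrier C"
    and st: "s \<in> carrier T" "t \<in> carrier T"
    using xy by (auto simp: carrier_wreath)
  have eq': "base_action a (\<sigma> s z) = base_action b (\<sigma> t z)" for z
    using eq by (simp add: wreath_action_def fun_eq_iff)
  obtain z where z: "z \<in> J"
    using J_nonempty by blast
  have "\<sigma> s (\<iota> (a s) z) = \<sigma> t (\<iota> (b t) z)"
    using eq'[of z] z st by (simp add: base_action_translate)
  moreover have "\<iota> (a s) z \<in> J" "\<iota> (b t) z \<in> J"
    using a b st z by (auto intro!: \<iota>_maps_J)
  ultimately have "s = t"
    using st translates_disjoint by blast
  moreover have "a = b"
  proof (rule PiE_ext[OF a b])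
    fix r assume r: "r \<in> carrier T"
    have base_eq: "base_action a w = base_action b w" for w
      using eq'[of "\<sigma> (inv\<^bsub>T\<^esub> s) w"] st \<open>s = t\<close> by (simp add: \<sigma>_inv)
    have abr: "a r \<in> carrier C" "b r \<in> carrier C"
      using a b r by auto
    have "\<iota> (a r) w = \<iota> (b r) w" for w
    proof (cases "w \<in> J")
      case True
      then show ?thesis
        using base_eq[of "\<sigma> r w"] r by (simp add: base_action_translate \<sigma>_eq_iff)
    next
      case False
      then show ?thesis
        using abr by (simp add: \<iota>_support)
    qed
    then show "a r = b r"
      using \<iota>_inj abr by (auto dest: inj_onD)
  qed
  ultimately show "x = y" by simp
qed

lemma wreath_action_in_closed_set:
  assumes "\<And>f g. f \<in> P \<Longrightarrow> g \<in> P \<Longrightarrow> f \<circ> g \<in> P"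
    and "\<And>t. t \<in> carrier T \<Longrightarrow> \<sigma> t \<in> P"
    and "\<And>c. c \<in> carrier C \<Longrightarrow> \<iota> c \<in> P"
    and "x \<in> carrier (restricted_wreath_product C T)"
  shows "wreath_action x \<in> P"
proof -
  obtain a t where x: "x = (a, t)" by (cases x)
  have "base_action a \<in> P"
    using assms by (intro base_action_in_closed_set[where A = "{t \<in> carrier T. a t \<noteq> \<one>\<^bsub>C\<^esub>}"])
      (auto simp: carrier_wreath x)
  with assms show ?thesis
    by (auto simp: wreath_action_def x carrier_wreath)
qed

end

section \<open>Piecewise linear maps of the line\<close>

lemma piecewise_linearD:
  assumes "piecewise_linear S B f" "x < y" "{x..y} \<subseteq> S" "{x<..<y} \<inter> B = {}"
  obtains m c where "\<And>t. t \<in> {x..y} \<Longrightarrow> f t = m * t + c"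
proof -
  obtain m c where "\<forall>t\<in>{x..y}. f t = m * t + c"
    using assms unfolding piecewise_linear_def by blast
  then show ?thesis
    by (intro that[of m c]) blast
qed

lemma convex_real_Icc_subset:
  fixes S :: "real set"
  assumes "convex S" "x \<in> S" "y \<in> S"
  shows "{x..y} \<subseteq> S"
  using assms by (meson connected_contains_Icc convex_connected)

text \<open>The composite can break only where \<open>f\<close> breaks or where \<open>f\<close>
  meets a breakpoint of \<open>g\<close>. Elsewhere \<open>f\<close> maps \<open>{x..y}\<close> into
  \<open>{f x..f y}\<close>, which convexity keeps inside \<open>S'\<close> and whose interior
  avoids \<open>B'\<close>.\<close>

lemma piecewise_linear_compose:
  assumes f: "piecewise_linear S B f" and g: "piecewise_linear S' B' g"
    and mono: "strict_mono_on S f" and img: "f ` S = S'" and "convex S'"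
  shows "piecewise_linear S (B \<union> {x \<in> S. f x \<in> B'}) (g \<circ> f)"
  unfolding piecewise_linear_def
proof (intro allI impI, elim conjE)
  fix x y :: real
  assume xy: "x < y" "{x..y} \<subseteq> S" and B: "{x<..<y} \<inter> (B \<union> {x \<in> S. f x \<in> B'}) = {}"
  have "{x<..<y} \<inter> B = {}"
    using B by blast
  then obtain m c where mc: "\<And>t. t \<in> {x..y} \<Longrightarrow> f t = m * t + c"
    using piecewise_linearD[OF f xy] by metis
  have S: "x \<in> S" "y \<in> S"
    using xy by auto
  have "f x < f y"
    using strict_mono_onD[OF mono] S xy by blast
  moreover have sub: "{f x..f y} \<subseteq> S'"
    using \<open>convex S'\<close> img S by (intro convex_real_Icc_subset) auto
  moreover have "{f x<..<f y} \<inter> B' = {}"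
  proof (rule ccontr)
    assume "{f x<..<f y} \<inter> B' \<noteq> {}"
    then obtain z where z: "f x < z" "z < f y" "z \<in> B'" by auto
    then have "z \<in> f ` S"
      using sub img by auto
    then obtain u where u: "u \<in> S" "z = f u" by blast
    then have "x < u" "u < y"
      using z S strict_mono_on_less[OF mono] by auto
    with u z B show False by auto
  qed
  ultimately obtain m' c' where mc': "\<And>t. t \<in> {f x..f y} \<Longrightarrow> g t = m' * t + c'"
    using g piecewise_linearD by metis
  show "\<exists>m c. \<forall>t\<in>{x..y}. (g \<circ> f) t = m * t + c"
  proof (intro exI ballI)
    fix t assume t: "t \<in> {x..y}"
    then have "t \<in> S" using xy by auto
    with t have "f t \<in> {f x..f y}"
      using S strict_mono_on_leD[OF mono] by auto
    then show "(g \<circ> f) t = (m' * m) * t + (m' * c + c')"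
      using mc[OF t] mc' by (simp add: algebra_simps)
  qed
qed

lemma piecewise_linear_inverse:
  assumes f: "piecewise_linear S B f"
    and mono: "strict_mono_on S f" and img: "f ` S = S'" and "convex S"
    and g: "\<And>x. x \<in> S \<Longrightarrow> g (f x) = x"
  shows "piecewise_linear S' (f ` (B \<inter> S)) g"
  unfolding piecewise_linear_def
proof (intro allI impI, elim conjE)
  fix x y :: real
  assume xy: "x < y" "{x..y} \<subseteq> S'" and B: "{x<..<y} \<inter> f ` (B \<inter> S) = {}"
  then have "x \<in> f ` S" "y \<in> f ` S"
    using img by auto
  then obtain u v where uv: "u \<in> S" "v \<in> S" "x = f u" "y = f v"
    by blast
  have "u < v"
    using uv xy strict_mono_on_less[OF mono] by auto
  moreover have sub: "{u..v} \<subseteq> S"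
    using \<open>convex S\<close> uv by (intro convex_real_Icc_subset) auto
  moreover have "{u<..<v} \<inter> B = {}"
  proof (rule ccontr)
    assume "{u<..<v} \<inter> B \<noteq> {}"
    then obtain w where w: "u < w" "w < v" "w \<in> B" by auto
    then have "w \<in> S" using sub by auto
    then have "f w \<in> {x<..<y}"
      using uv w strict_mono_onD[OF mono] by auto
    with w \<open>w \<in> S\<close> B show False by auto
  qed
  ultimately obtain m c where mc: "\<And>t. t \<in> {u..v} \<Longrightarrow> f t = m * t + c"
    using f piecewise_linearD by metis
  \<comment> \<open>The endpoints have different images, so the slope of \<open>f\<close> is nonzero
    and the affine formula can be solved for the argument.\<close>
  have "y - x = m * (v - u)"
    using mc[of u] mc[of v] uv \<open>u < v\<close> by (simp add: algebra_simps)
  then have "m \<noteq> 0"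
    using xy by auto
  show "\<exists>m c. \<forall>t\<in>{x..y}. g t = m * t + c"
  proof (intro exI ballI)
    fix t assume t: "t \<in> {x..y}"
    then have "t \<in> f ` S"
      using xy img by auto
    then obtain w where w: "w \<in> S" "t = f w" by blast
    then have "w \<in> {u..v}"
      using t uv strict_mono_on_less_eq[OF mono] by auto
    then have "t = m * w + c"
      using mc w by auto
    then show "g t = (1 / m) * t + (- c / m)"
      using \<open>m \<noteq> 0\<close> g[OF w(1)] w(2) by (simp add: field_simps)
  qed
qed

text \<open>
  Breakpoints need only be locally finite: the conjugating maps \<open>R\<^sub>n\<close> do not commute with the unit
  translation, so their breakpoints cannot be counted on the circle.
\<close>

definition PL_line :: "(real \<Rightarrow> real) set" where
  "PL_line = {F. strict_mono F \<and> surj F \<and>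
    (\<exists>B. (\<forall>a b. finite (B \<inter> {a..b})) \<and> piecewise_linear UNIV B F)}"

lemma PL_line_translate: "(\<lambda>x. x + c) \<in> PL_line"
proof -
  have "surj (\<lambda>x::real. x + c)"
    by (rule surjI[of _ "\<lambda>x. x - c"]) simp
  moreover have "piecewise_linear UNIV {} (\<lambda>x. x + c)"
    unfolding piecewise_linear_def by (intro allI impI exI[of _ 1] exI[of _ c]) simp
  ultimately show ?thesis
    by (auto simp: PL_line_def strict_mono_def)
qed

lemma PL_line_compose:
  assumes "F \<in> PL_line" "G \<in> PL_line"
  shows "G \<circ> F \<in> PL_line"
proof -
  obtain B B' where B: "\<And>a b. finite (B \<inter> {a..b})" "piecewise_linear UNIV B F"
    and B': "\<And>a b. finite (B' \<inter> {a..b})" "piecewise_linear UNIV B' G"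
    and F: "strict_mono F" "surj F" and G: "strict_mono G" "surj G"
    using assms by (auto simp: PL_line_def)
  have "finite ((B \<union> {x \<in> UNIV. F x \<in> B'}) \<inter> {a..b})" for a b
  proof -
    \<comment> \<open>By monotonicity, \<open>F\<close> embeds the pulled-back breakpoints of a
      bounded interval into those of \<open>G\<close> in another bounded interval.\<close>
    have "F ` ({x. F x \<in> B'} \<inter> {a..b}) \<subseteq> B' \<inter> {F a..F b}"
      using F by (auto simp: strict_mono_less_eq)
    then have "finite (F ` ({x. F x \<in> B'} \<inter> {a..b}))"
      using B' finite_subset by blast
    then have "finite ({x. F x \<in> B'} \<inter> {a..b})"
      using F by (auto intro: finite_imageD inj_on_subset strict_mono_imp_inj_on)
    with B show ?thesis by (simp add: Int_Un_distrib2)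
  qed
  moreover have "piecewise_linear UNIV (B \<union> {x \<in> UNIV. F x \<in> B'}) (G \<circ> F)"
    using B B' F by (intro piecewise_linear_compose[of _ _ _ UNIV])
      (auto simp: strict_mono_on_def strict_mono_def)
  moreover have "strict_mono (G \<circ> F)"
    using F G by (intro strict_mono_o)
  moreover have "surj (G \<circ> F)"
    using F G by (intro comp_surj)
  ultimately show ?thesis
    by (auto simp: PL_line_def)
qed

lemma PL_line_bij: "F \<in> PL_line \<Longrightarrow> bij F"
  by (auto simp: PL_line_def bij_def strict_mono_imp_inj_on)

lemma PL_line_inverse:
  assumes "F \<in> PL_line"
  shows "inv_into UNIV F \<in> PL_line"
proof -
  obtain B where B: "\<And>a b. finite (B \<inter> {a..b})" "piecewise_linear UNIV B F"
    and F: "strict_mono F" "surj F"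
    using assms by (auto simp: PL_line_def)
  have "bij F" using assms by (rule PL_line_bij)
  have "finite (F ` (B \<inter> UNIV) \<inter> {a..b})" for a b
  proof -
    have "F ` (B \<inter> UNIV) \<inter> {a..b} \<subseteq> F ` (B \<inter> {inv_into UNIV F a..inv_into UNIV F b})"
    proof
      fix y assume "y \<in> F ` (B \<inter> UNIV) \<inter> {a..b}"
      then obtain x where x: "x \<in> B" "y = F x" "a \<le> F x" "F x \<le> b" by auto
      then have "F (inv_into UNIV F a) \<le> F x" "F x \<le> F (inv_into UNIV F b)"
        using F by (auto simp: surj_f_inv_f)
      with x F show "y \<in> F ` (B \<inter> {inv_into UNIV F a..inv_into UNIV F b})"
        by (auto simp: strict_mono_less_eq)
    qed
    then show ?thesis
      using B finite_subset by blast
  qed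
  moreover have "piecewise_linear UNIV (F ` (B \<inter> UNIV)) (inv_into UNIV F)"
    using B F \<open>bij F\<close> by (intro piecewise_linear_inverse[of UNIV])
      (auto simp: strict_mono_on_def strict_mono_def bij_def)
  moreover have "strict_mono (inv_into UNIV F)"
  proof (rule strict_monoI)
    fix x y :: real assume "x < y"
    then have "F (inv_into UNIV F x) < F (inv_into UNIV F y)"
      using F by (simp add: surj_f_inv_f)
    then show "inv_into UNIV F x < inv_into UNIV F y"
      using F by (simp add: strict_mono_less)
  qed
  moreover have "surj (inv_into UNIV F)"
    using \<open>bij F\<close> by (simp add: bij_imp_bij_inv bij_is_surj)
  ultimately show ?thesis
    unfolding PL_line_def by blast
qed

text \<open>A monotone map whose image is open, here the whole line, has no jumps.\<close>

lemma PL_line_continuous: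
  assumes "F \<in> PL_line"
  shows "continuous_on UNIV F"
  using assms by (intro continuous_onI_mono) (auto simp: PL_line_def strict_mono_less_eq)

section \<open>Extending a map of the unit interval to the line with F(x + 1) = F(x) + m\<close>

definition extend_by_degree :: "real \<Rightarrow> (real \<Rightarrow> real) \<Rightarrow> real \<Rightarrow> real" where
  "extend_by_degree m h x = m * \<lfloor>x\<rfloor> + h (frac x)"

lemma extend_by_degree_add_int:
  "extend_by_degree m h (x + of_int k) = extend_by_degree m h x + m * of_int k"
  by (simp add: extend_by_degree_def frac_def algebra_simps)

lemma extend_by_degree_unit_interval:
  assumes "h 0 = 0" "h 1 = m" "x \<in> {0..1}"
  shows "extend_by_degree m h x = h x"
proof (cases "x = 1")
  case False
  then have "\<lfloor>x\<rfloor> = 0"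
    using assms by (auto simp: floor_eq_iff)
  then show ?thesis
    by (simp add: extend_by_degree_def frac_def)
qed (use assms in \<open>simp add: extend_by_degree_def\<close>)

lemma endpoints_fixed:
  fixes f :: "real \<Rightarrow> real"
  assumes mono: "strict_mono_on {a..b} f" and img: "f ` {a..b} = {c..d}" and "a \<le> b"
  shows "f a = c" "f b = d"
proof -
  have "f a \<in> {c..d}" "f b \<in> {c..d}"
    using img \<open>a \<le> b\<close> by auto
  then have "c \<in> f ` {a..b}" "d \<in> f ` {a..b}"
    using img by auto
  then obtain u v where uv: "u \<in> {a..b}" "f u = c" "v \<in> {a..b}" "f v = d" by blast
  then have "f a \<le> c" "d \<le> f b"
    using strict_mono_on_leD[OF mono, of a u] strict_mono_on_leD[OF mono, of v b] \<open>a \<le> b\<close> by auto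
  with \<open>f a \<in> {c..d}\<close> \<open>f b \<in> {c..d}\<close> show "f a = c" "f b = d" by auto
qed

text \<open>Over each interval from j to j + 1 the graph is a translate of that of \<open>h\<close>,
  and the endpoint values 0 and m make consecutive pieces fit. The integers join the breakpoints
  because the slopes of \<open>h\<close> at its two ends may differ.\<close>

lemma extend_by_degree_PL:
  assumes mono: "strict_mono_on {0..1} h" and img: "h ` {0..1} = {0..m}" and "m > 0"
    and "finite B" and PL: "piecewise_linear {0..1} B h"
  shows "extend_by_degree m h \<in> PL_line"
proof -
  have h01: "h 0 = 0" "h 1 = m"
    using endpoints_fixed[OF mono img] by auto
  have frac_mem: "frac x \<in> {0..1}" "frac x < 1" for x :: real
    using frac_lt_1[of x] by auto
  have "strict_mono (extend_by_degree m h)"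
  proof (rule strict_monoI)
    fix x y :: real assume "x < y"
    show "extend_by_degree m h x < extend_by_degree m h y"
    proof (cases "\<lfloor>x\<rfloor> = \<lfloor>y\<rfloor>")
      case True
      then have "frac x < frac y"
        using \<open>x < y\<close> by (simp add: frac_def)
      then show ?thesis
        using strict_mono_onD[OF mono] frac_mem True by (auto simp: extend_by_degree_def)
    next
      case False
      then have "\<lfloor>x\<rfloor> + 1 \<le> \<lfloor>y\<rfloor>"
        using \<open>x < y\<close> by (metis floor_mono less_le add1_zle_eq)
      then have "real_of_int (\<lfloor>x\<rfloor> + 1) \<le> real_of_int \<lfloor>y\<rfloor>"
        by (simp only: of_int_le_iff)
      then have "m * (of_int \<lfloor>x\<rfloor> + 1) \<le> m * of_int \<lfloor>y\<rfloor>"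
        using \<open>m > 0\<close> by simp
      moreover have "h (frac x) < m"
        using strict_mono_onD[OF mono, of "frac x" 1] frac_mem h01 by auto
      moreover have "h (frac y) \<ge> 0"
        using img frac_mem by (metis atLeastAtMost_iff image_eqI)
      ultimately show ?thesis
        by (simp add: extend_by_degree_def algebra_simps)
    qed
  qed
  moreover have "surj (extend_by_degree m h)"
  proof (intro surjI)
    fix y :: real
    \<comment> \<open>Division of \<open>y\<close> by \<open>m\<close> with remainder: the preimage
      is the quotient, the floor of \<open>y / m\<close>, plus a point \<open>u\<close> that
      \<open>h\<close> sends to the remainder \<open>r\<close>.\<close>
    define r where "r = frac (y / m) * m"
    have "r \<in> {0..m}" "r < m"
      using \<open>m > 0\<close> frac_lt_1[of "y / m"] by (auto simp: r_def)
    with img have "r \<in> h ` {0..1}" by simp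
    then obtain u where u: "u \<in> {0..1}" "h u = r" by auto
    with \<open>r < m\<close> h01 have "u \<noteq> 1" by auto
    then have "\<lfloor>u\<rfloor> = 0"
      using u by (auto simp: floor_eq_iff)
    then have "extend_by_degree m h (u + of_int \<lfloor>y / m\<rfloor>) = r + m * \<lfloor>y / m\<rfloor>"
      using u by (simp add: extend_by_degree_def frac_def)
    also have "\<dots> = y"
      using \<open>m > 0\<close> by (simp add: r_def frac_def algebra_simps)
    finally have "\<exists>x. extend_by_degree m h x = y" by blast
    then show "extend_by_degree m h (SOME x. extend_by_degree m h x = y) = y"
      by (rule someI_ex)
  qed
  moreover have "finite ({x. frac x \<in> insert 0 B} \<inter> {a..b})" for a b
  proof (rule finite_subset)
    show "{x. frac x \<in> insert 0 B} \<inter> {a..b} \<subseteq>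
        (\<Union>j\<in>{\<lfloor>a\<rfloor>..\<lfloor>b\<rfloor>}. (\<lambda>u. of_int j + u) ` insert 0 B)"
    proof
      fix x assume "x \<in> {x. frac x \<in> insert 0 B} \<inter> {a..b}"
      then have "frac x \<in> insert 0 B" "\<lfloor>x\<rfloor> \<in> {\<lfloor>a\<rfloor>..\<lfloor>b\<rfloor>}" "x = of_int \<lfloor>x\<rfloor> + frac x"
        by (auto simp: floor_mono frac_def)
      then show "x \<in> (\<Union>j\<in>{\<lfloor>a\<rfloor>..\<lfloor>b\<rfloor>}. (\<lambda>u. of_int j + u) ` insert 0 B)"
        by blast
    qed
    show "finite (\<Union>j\<in>{\<lfloor>a\<rfloor>..\<lfloor>b\<rfloor>}. (\<lambda>u. real_of_int j + u) ` insert 0 B)"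
      using \<open>finite B\<close> by auto
  qed
  moreover have "piecewise_linear UNIV {x. frac x \<in> insert 0 B} (extend_by_degree m h)"
    unfolding piecewise_linear_def
  proof (intro allI impI, elim conjE)
    fix x y :: real
    assume "x < y" and B: "{x<..<y} \<inter> {x. frac x \<in> insert 0 B} = {}"
    define j where "j = \<lfloor>x\<rfloor>"
    have "of_int j \<le> x" "x < of_int j + 1"
      by (auto simp: j_def)
    \<comment> \<open>Every integer is a breakpoint, so the interval cannot reach past
      \<open>j + 1\<close>. It may end exactly there, which is why the unit interval is taken closed
      below.\<close>
    have "y \<le> of_int j + 1"
    proof (rule ccontr)
      assume "\<not> y \<le> of_int j + 1"
      then have "of_int (j + 1) \<in> {x<..<y} \<inter> {x. frac x \<in> insert 0 B}"
        using \<open>x < of_int j + 1\<close> by (simp del: of_int_add add: frac_of_int)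
      with B show False by blast
    qed
    have "{x - of_int j<..<y - of_int j} \<inter> B = {}"
    proof (rule ccontr)
      assume "{x - of_int j<..<y - of_int j} \<inter> B \<noteq> {}"
      then obtain u where "u \<in> B" "u \<in> {x - of_int j<..<y - of_int j}" by blast
      then have u: "u \<in> B" "x < u + of_int j" "u + of_int j < y" by auto
      then have "\<lfloor>u\<rfloor> = 0"
        using \<open>of_int j \<le> x\<close> \<open>y \<le> of_int j + 1\<close> \<open>of_int j \<le> x\<close> by (auto simp: floor_eq_iff)
      then have "frac (u + of_int j) = u"
        by (simp add: frac_def)
      with u B show False by fastforce
    qed
    then obtain p c where pc: "\<And>t. t \<in> {x - of_int j..y - of_int j} \<Longrightarrow> h t = p * t + c"
      using PL \<open>x < y\<close> \<open>of_int j \<le> x\<close> \<open>y \<le> of_int j + 1\<close>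
      by (elim piecewise_linearD[of "{0..1}" B h "x - of_int j" "y - of_int j"]) auto
    show "\<exists>m' c. \<forall>t\<in>{x..y}. extend_by_degree m h t = m' * t + c"
    proof (intro exI ballI)
      fix t assume t: "t \<in> {x..y}"
      have "extend_by_degree m h t = extend_by_degree m h (t - of_int j) + m * j"
        using extend_by_degree_add_int[of m h "t - of_int j" j] by simp
      also have "extend_by_degree m h (t - of_int j) = h (t - of_int j)"
        using t \<open>of_int j \<le> x\<close> \<open>y \<le> of_int j + 1\<close> h01
        by (intro extend_by_degree_unit_interval) auto
      also have "h (t - of_int j) = p * (t - of_int j) + c"
        using t by (intro pc) auto
      finally show "extend_by_degree m h t = p * t + (c - p * of_int j + m * of_int j)"
        by (simp add: algebra_simps)
    qed
  qed
  ultimately show ?thesis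
    unfolding PL_line_def by blast
qed

section \<open>Half-scale copies of interval maps, completed by an affine piece\<close>

definition half_glue :: "real \<Rightarrow> (real \<Rightarrow> real) \<Rightarrow> real \<Rightarrow> real" where
  "half_glue m f u = (if u \<le> 1/2 then f (2 * u) / 2 else m - (2 * m - 1) * (1 - u))"

text \<open>One construction with two uses: \<open>bump m (\<lambda>x. x)\<close> is the map
  \<open>S\<^sub>m\<close> that builds the blow-up, while \<open>bump 1 f\<close> lifts the circle
  map that acts as \<open>f\<close> on a half circle and trivially on the rest.\<close>

definition bump :: "real \<Rightarrow> (real \<Rightarrow> real) \<Rightarrow> real \<Rightarrow> real" where
  "bump m f = extend_by_degree m (half_glue m f)"

context
  fixes m :: real and f :: "real \<Rightarrow> real"
  assumes m: "1 \<le> m"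
    and mono: "strict_mono_on {0..1} f" and img: "f ` {0..1} = {0..1}"
begin

lemma half_glue_strict_mono: "strict_mono_on {0..1} (half_glue m f)"
proof (rule strict_mono_onI)
  fix x y :: real assume xy: "x \<in> {0..1}" "y \<in> {0..1}" "x < y"
  consider "y \<le> 1/2" | "x \<le> 1/2" "1/2 < y" | "1/2 < x"
    by linarith
  then show "half_glue m f x < half_glue m f y"
  proof cases
    case 1
    then show ?thesis
      using xy strict_mono_onD[OF mono, of "2 * x" "2 * y"] by (simp add: half_glue_def)
  next
    case 2
    then have "f (2 * x) \<in> f ` {0..1}"
      using xy by (intro imageI) auto
    then have "f (2 * x) \<le> 1"
      using img by auto
    moreover have "(2 * m - 1) * (1 - y) < (2 * m - 1) * (1 / 2)"
      using 2 m by (intro mult_strict_left_mono) auto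
    ultimately show ?thesis
      using 2 by (simp add: half_glue_def algebra_simps)
  next
    case 3
    have "(2 * m - 1) * (1 - y) < (2 * m - 1) * (1 - x)"
      using xy m by (intro mult_strict_left_mono) auto
    then show ?thesis
      using 3 xy by (simp add: half_glue_def)
  qed
qed

lemma half_glue_endpoints: "half_glue m f 0 = 0" "half_glue m f 1 = m"
  using endpoints_fixed[OF mono img] by (auto simp: half_glue_def)

text \<open>The two branches agree at 1/2, since \<open>f 1 = 1\<close> gives both the value 1/2.
  Hence 1/2 may be counted on the affine side too.\<close>

lemma half_glue_right:
  assumes "u \<ge> 1/2"
  shows "half_glue m f u = m - (2 * m - 1) * (1 - u)"
  using endpoints_fixed[OF mono img] assms
  by (cases "u = 1/2") (auto simp: half_glue_def field_simps)

lemma half_glue_image: "half_glue m f ` {0..1} = {0..m}"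
proof
  show "half_glue m f ` {0..1} \<subseteq> {0..m}"
  proof
    fix y assume "y \<in> half_glue m f ` {0..1}"
    then obtain x where "x \<in> {0..1}" "y = half_glue m f x" by blast
    then show "y \<in> {0..m}"
      using strict_mono_on_leD[OF half_glue_strict_mono, of 0 x]
        strict_mono_on_leD[OF half_glue_strict_mono, of x 1] half_glue_endpoints by auto
  qed
  show "{0..m} \<subseteq> half_glue m f ` {0..1}"
  proof
    fix y assume y: "y \<in> {0..m}"
    show "y \<in> half_glue m f ` {0..1}"
    proof (cases "y \<le> 1/2")
      case True
      then have "2 * y \<in> f ` {0..1}"
        using y img by auto
      then obtain v where v: "v \<in> {0..1}" "2 * y = f v" by blast
      then have "half_glue m f (v / 2) = y"
        by (simp add: half_glue_def)
      with v show ?thesis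
        by (intro image_eqI[of _ _ "v / 2"]) auto
    next
      case False
      \<comment> \<open>This solves the affine branch for the value \<open>y\<close>.\<close>
      define u where "u = 1 - (m - y) / (2 * m - 1)"
      have u: "u \<in> {1/2..1}"
        using m y False by (auto simp: u_def field_simps)
      then have "half_glue m f u = y"
        using m by (simp add: half_glue_right u_def)
      with u show ?thesis
        by (intro image_eqI[of _ _ u]) auto
    qed
  qed
qed

lemma half_glue_piecewise_linear:
  assumes PL: "piecewise_linear {0..1} B f"
  shows "piecewise_linear {0..1} (insert (1/2) ((\<lambda>u. u / 2) ` B)) (half_glue m f)"
  unfolding piecewise_linear_def
proof (intro allI impI, elim conjE)
  fix x y :: real
  assume xy: "x < y" "{x..y} \<subseteq> {0..1}"
    and B: "{x<..<y} \<inter> insert (1/2) ((\<lambda>u. u / 2) ` B) = {}"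
  then have "0 \<le> x" "y \<le> 1" by auto
  have "1/2 \<notin> {x<..<y}"
    using B by blast
  then consider "1/2 \<le> x" | "y \<le> 1/2"
    by force
  then show "\<exists>m' c. \<forall>t\<in>{x..y}. half_glue m f t = m' * t + c"
  proof cases
    case 1
    show ?thesis
    proof (intro exI ballI)
      fix t assume "t \<in> {x..y}"
      then show "half_glue m f t = (2 * m - 1) * t + (m - (2 * m - 1))"
        using 1 by (simp add: half_glue_right algebra_simps)
    qed
  next
    case 2
    have "{2 * x<..<2 * y} \<inter> B = {}"
    proof (rule ccontr)
      assume "{2 * x<..<2 * y} \<inter> B \<noteq> {}"
      then obtain u where "u \<in> B" "u / 2 \<in> {x<..<y}" by force
      with B show False by blast
    qed
    then obtain p c where pc: "\<And>t. t \<in> {2 * x..2 * y} \<Longrightarrow> f t = p * t + c"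
      using PL xy \<open>0 \<le> x\<close> 2
      by (elim piecewise_linearD[of "{0..1}" B f "2 * x" "2 * y"]) auto
    show ?thesis
    proof (intro exI ballI)
      fix t assume "t \<in> {x..y}"
      then show "half_glue m f t = p * t + c / 2"
        using 2 pc[of "2 * t"] by (simp add: half_glue_def)
    qed
  qed
qed

lemma bump_PL_line:
  assumes "finite B" "piecewise_linear {0..1} B f"
  shows "bump m f \<in> PL_line"
  unfolding bump_def
  using m assms half_glue_strict_mono half_glue_image half_glue_piecewise_linear
  by (intro extend_by_degree_PL[where B = "insert (1/2) ((\<lambda>u. u / 2) ` B)"]) auto

lemma bump_left:
  assumes "u \<in> {0..1/2}"
  shows "bump m f u = f (2 * u) / 2"
  using assms half_glue_endpoints
  by (simp add: bump_def extend_by_degree_unit_interval) (simp add: half_glue_def)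

end

lemma bump_right:
  assumes "strict_mono_on {0..1} f" "f ` {0..1} = {0..1}" "u \<in> {1/2..1}"
  shows "bump 1 f u = u"
  using assms half_glue_endpoints[OF _ assms(1,2), of 1] half_glue_right[OF _ assms(1,2), of 1 u]
  by (simp add: bump_def extend_by_degree_unit_interval)

lemma bump_add_int: "bump m f (x + of_int k) = bump m f x + m * of_int k"
  by (simp add: bump_def extend_by_degree_add_int)

section \<open>A blown-up action of the rationals\<close>

text \<open>This is \<open>R\<^sub>n\<close>. The degrees 1, ..., n of its factors multiply to n!,
  so that R(x + 1) = R(x) + n!, and conjugating the unit translation by it gives an n!-th root of
  the unit translation.\<close>

fun blow_down :: "nat \<Rightarrow> real \<Rightarrow> real" where
  "blow_down 0 = id"
| "blow_down (Suc n) = bump (Suc n) (\<lambda>x. x) \<circ> blow_down n"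

lemma strict_mono_on_ident: "strict_mono_on S (\<lambda>x::real. x)"
  by (simp add: strict_mono_on_def)

lemma piecewise_linear_ident: "piecewise_linear S {} (\<lambda>x. x)"
  unfolding piecewise_linear_def by (intro allI impI exI[of _ 1] exI[of _ 0]) simp

lemma blow_down_PL_line: "blow_down n \<in> PL_line"
proof (induction n)
  case 0
  show ?case
    using PL_line_translate[of 0] by (simp add: id_def)
next
  case (Suc n)
  have "bump (Suc n) (\<lambda>x. x) \<in> PL_line"
    using piecewise_linear_ident
    by (intro bump_PL_line[where B = "{}"]) (auto simp: strict_mono_on_ident)
  with Suc show ?case
    unfolding blow_down.simps by (rule PL_line_compose)
qed

lemma blow_down_fixes:
  assumes "x \<in> {0..1/2}"
  shows "blow_down n x = x"
proof (induction n)
  case (Suc n)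
  then show ?case
    using assms by (simp add: bump_left strict_mono_on_ident)
qed simp

text \<open>Each level is an action of all rationals, but different levels are guaranteed to agree
  on \<open>q\<close> only once \<open>q * fact n\<close> is an integer.\<close>

definition level_action :: "nat \<Rightarrow> rat \<Rightarrow> real \<Rightarrow> real" where
  "level_action n q =
    inv_into UNIV (blow_down n) \<circ> (\<lambda>x. x + of_rat (q * fact n)) \<circ> blow_down n"

lemma level_action_PL_line: "level_action n q \<in> PL_line"
  unfolding level_action_def
  by (intro PL_line_compose PL_line_inverse PL_line_translate blow_down_PL_line)

lemma blow_down_level_action:
  "blow_down n (level_action n q x) = blow_down n x + of_rat (q * fact n)"
  using PL_line_bij[OF blow_down_PL_line, of n]
  by (simp add: level_action_def bij_is_surj surj_f_inv_f)

lemma level_action_eqI: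
  assumes "blow_down n y = blow_down n x + of_rat (q * fact n)"
  shows "level_action n q x = y"
  using assms PL_line_bij[OF blow_down_PL_line, of n] blow_down_level_action[of n q x]
  by (metis bij_is_inj injD)

text \<open>The new factor of \<open>blow_down (Suc n)\<close> turns a translation by an integer k
  into one by (n + 1) k, exactly the change from \<open>q * fact n\<close> to
  \<open>q * fact (Suc n)\<close>. It does so for integer translations, whence the
  assumption.\<close>

lemma level_action_Suc:
  assumes "q * fact n \<in> \<int>"
  shows "level_action (Suc n) q = level_action n q"
proof
  fix x
  obtain k where k: "q * fact n = of_int k"
    using assms by (auto elim: Ints_cases)
  have k': "q * fact (Suc n) = of_int (int (Suc n) * k)"
    by (simp add: k[symmetric] algebra_simps)
  show "level_action (Suc n) q x = level_action n q x"
  proof (rule level_action_eqI)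
    have "blow_down (Suc n) (level_action n q x) = bump (Suc n) (\<lambda>x. x) (blow_down n x + of_int k)"
      by (simp add: blow_down_level_action k)
    also have "\<dots> = blow_down (Suc n) x + of_rat (q * fact (Suc n))"
      unfolding bump_add_int k' by (simp only: of_rat_of_int_eq) simp
    finally show "blow_down (Suc n) (level_action n q x) =
      blow_down (Suc n) x + of_rat (q * fact (Suc n))" .
  qed
qed

lemma level_action_mono:
  assumes "q * fact n \<in> \<int>" "n \<le> n'"
  shows "level_action n' q = level_action n q \<and> q * fact n' \<in> \<int>"
  using assms(2)
proof (induction n' rule: dec_induct)
  case base
  with assms show ?case by simp
next
  case (step k)
  have "q * fact (Suc k) = of_nat (Suc k) * (q * fact k)"
    by (simp add: algebra_simps)
  then have "q * fact (Suc k) \<in> \<int>"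
    using step by (metis Ints_mult Ints_of_nat)
  with step show ?case
    by (simp add: level_action_Suc)
qed

text \<open>The denominator of \<open>q\<close> divides its own factorial.\<close>

lemma ex_level: "\<exists>n. (q::rat) * fact n \<in> \<int>"
proof -
  obtain a b where ab: "quotient_of q = (a, b)" by (cases "quotient_of q")
  then have "b > 0" "q = of_int a / of_int b"
    by (auto simp: quotient_of_denom_pos quotient_of_div)
  have "b dvd fact (nat b)"
  proof -
    have "nat b dvd fact (nat b)"
      using \<open>b > 0\<close> by (intro dvd_fact) auto
    then have "int (nat b) dvd int (fact (nat b))"
      by (simp only: int_dvd_int_iff)
    then show ?thesis
      using \<open>b > 0\<close> by simp
  qed
  then obtain c where "fact (nat b) = b * c" ..
  then have "(fact (nat b) :: rat) = of_int b * of_int c"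
    by (metis of_int_fact of_int_mult)
  then have "q * fact (nat b) = of_int (a * c)"
    using \<open>b > 0\<close> \<open>q = _\<close> by simp
  then show ?thesis
    by (metis Ints_of_int)
qed

definition rat_action :: "rat \<Rightarrow> real \<Rightarrow> real" where
  "rat_action q = level_action (SOME n. q * fact n \<in> \<int>) q"

text \<open>Any two admissible levels agree with the larger of them, so the choice made by
  \<open>SOME\<close> is immaterial.\<close>

lemma rat_action_eq:
  assumes "q * fact n \<in> \<int>"
  shows "rat_action q = level_action n q"
proof -
  let ?n = "SOME n. q * fact n \<in> \<int>"
  have n: "q * fact ?n \<in> \<int>"
    by (rule someI_ex[OF ex_level])
  have "level_action ?n q = level_action (max n ?n) q"
    using level_action_mono[OF n, of "max n ?n"] by simp
  also have "\<dots> = level_action n q"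
    using level_action_mono[OF assms, of "max n ?n"] by simp
  finally show ?thesis
    by (simp add: rat_action_def)
qed

lemma rat_action_PL_line: "rat_action q \<in> PL_line"
  by (simp add: rat_action_def level_action_PL_line)

text \<open>On a level admissible for both rationals the two maps are conjugates of translations by
  the same map.\<close>

lemma rat_action_add: "rat_action (q + r) = rat_action q \<circ> rat_action r"
proof -
  obtain n1 n2 where n12: "q * fact n1 \<in> \<int>" "r * fact n2 \<in> \<int>"
    using ex_level by meson
  define n where "n = max n1 n2"
  have q: "q * fact n \<in> \<int>" and r: "r * fact n \<in> \<int>"
    using level_action_mono[OF n12(1)] level_action_mono[OF n12(2)] by (auto simp: n_def)
  then have qr: "(q + r) * fact n \<in> \<int>"
    by (simp add: distrib_right)
  have "level_action n (q + r) x = level_action n q (level_action n r x)" for x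
    by (rule level_action_eqI) (simp add: blow_down_level_action distrib_right of_rat_add)
  then show ?thesis
    using q r qr by (auto simp: rat_action_eq)
qed

lemma rat_action_of_int: "rat_action (of_int k) x = x + of_int k"
proof -
  have "rat_action (of_int k) = level_action 0 (of_int k)"
    by (rule rat_action_eq) simp
  moreover have "level_action 0 (of_int k) x = x + of_int k"
    by (rule level_action_eqI) simp
  ultimately show ?thesis by simp
qed

text \<open>At an admissible level, \<open>blow_down n\<close> conjugates the action to an integer
  translation and fixes both points, so they differ by an integer; two points of (0, 1/2) then
  coincide.\<close>

lemma rat_action_wandering:
  assumes "x \<in> {0<..<1/2}" "rat_action q x \<in> {0<..<1/2}"
  shows "q = 0"
proof -
  obtain n where n: "q * fact n \<in> \<int>"
    using ex_level by blast
  then obtain k where k: "q * fact n = of_int k"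
    by (auto elim: Ints_cases)
  have "blow_down n (rat_action q x) = blow_down n x + of_int k"
    unfolding rat_action_eq[OF n] blow_down_level_action k by simp
  then have "rat_action q x = x + of_int k"
    using assms by (simp add: blow_down_fixes)
  then have "\<bar>real_of_int k\<bar> < 1"
    using assms by auto
  then have "k = 0" by linarith
  with k show ?thesis by simp
qed

section \<open>Descending to the circle\<close>

lemma to_circle_eq_iff: "to_circle x = to_circle y \<longleftrightarrow> x - y \<in> \<int>"
  by (rule circle.abs_eq_iff)

lemma to_circle_rep: "to_circle (rep_circle c) = c"
  by (rule Quotient_abs_rep[OF Quotient_circle])

lemma to_circle_add_int [simp]: "to_circle (x + of_int k) = to_circle x"
  by (simp add: to_circle_eq_iff)

lemma to_circle_eqE:
  assumes "to_circle x = to_circle y"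
  obtains k where "x = y + of_int k"
proof -
  obtain k where "x - y = of_int k"
    using assms by (auto simp: to_circle_eq_iff elim: Ints_cases)
  then show ?thesis
    by (intro that[of k]) simp
qed

lemma to_circle_cases:
  obtains u where "0 \<le> u" "u < 1" "c = to_circle u"
proof (rule that[of "frac (rep_circle c)"])
  have "to_circle (frac (rep_circle c)) = to_circle (rep_circle c)"
    by (simp add: to_circle_eq_iff frac_def)
  then show "c = to_circle (frac (rep_circle c))"
    by (simp add: to_circle_rep)
qed (auto simp: frac_lt_1)

definition PL_lift :: "(real \<Rightarrow> real) set" where
  "PL_lift = {F \<in> PL_line. \<forall>x k. F (x + of_int k) = F x + of_int k}"

lemma PL_lift_compose:
  assumes "F \<in> PL_lift" "G \<in> PL_lift"
  shows "G \<circ> F \<in> PL_lift"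
  using assms PL_line_compose[of F G] by (auto simp: PL_lift_def)

lemma PL_lift_inverse:
  assumes "F \<in> PL_lift"
  shows "inv_into UNIV F \<in> PL_lift"
proof -
  have F: "F \<in> PL_line" and per: "\<And>x k. F (x + of_int k) = F x + of_int k"
    using assms by (auto simp: PL_lift_def)
  have "bij F"
    using F by (rule PL_line_bij)
  have "inv_into UNIV F (x + of_int k) = inv_into UNIV F x + of_int k" for x k
    using \<open>bij F\<close> per[of "inv_into UNIV F x" k]
    by (intro inv_f_eq) (auto simp: bij_def surj_f_inv_f)
  with F show ?thesis
    by (auto simp: PL_lift_def PL_line_inverse)
qed

text \<open>The representative is arbitrary; for members of \<open>PL_lift\<close>, which commute
  with integer translations, its choice does not matter.\<close>

definition descend :: "(real \<Rightarrow> real) \<Rightarrow> circle \<Rightarrow> circle" where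
  "descend F c = to_circle (F (rep_circle c))"

lemma descend_to_circle:
  assumes "F \<in> PL_lift"
  shows "descend F (to_circle x) = to_circle (F x)"
proof -
  have "to_circle (rep_circle (to_circle x)) = to_circle x"
    by (rule to_circle_rep)
  then obtain k where "rep_circle (to_circle x) = x + of_int k"
    by (rule to_circle_eqE)
  with assms show ?thesis
    by (simp add: descend_def PL_lift_def)
qed

lemma descend_compose:
  assumes "F \<in> PL_lift" "G \<in> PL_lift"
  shows "descend (G \<circ> F) = descend G \<circ> descend F"
proof
  fix c
  obtain x where "c = to_circle x" by (metis to_circle_rep)
  with assms show "descend (G \<circ> F) c = (descend G \<circ> descend F) c"
    by (simp add: descend_to_circle PL_lift_compose)
qed

lemma descend_inverse:
  assumes "F \<in> PL_lift"
  shows "descend (inv_into UNIV F) (descend F c) = c"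
    "descend F (descend (inv_into UNIV F) c) = c"
proof -
  obtain x where "c = to_circle x" by (metis to_circle_rep)
  moreover have "bij F"
    using assms by (auto simp: PL_lift_def PL_line_bij)
  ultimately show "descend (inv_into UNIV F) (descend F c) = c"
    "descend F (descend (inv_into UNIV F) c) = c"
    using assms by (simp_all add: descend_to_circle PL_lift_inverse bij_def surj_f_inv_f)
qed

text \<open>In the quotient topology openness is tested on the line, where the preimage under
  \<open>descend F\<close> pulls back to a preimage under the continuous map
  \<open>F\<close>.\<close>

lemma continuous_on_descend:
  assumes "F \<in> PL_lift"
  shows "continuous_on UNIV (descend F)"
  unfolding continuous_on_open_vimage[OF open_UNIV]
proof (intro allI impI)
  fix U :: "circle set" assume "open U"
  then have "open (to_circle -` U)"
    by (simp add: open_circle_def)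
  moreover have "continuous_on UNIV F"
    using assms by (auto simp: PL_lift_def intro: PL_line_continuous)
  ultimately have "open (F -` (to_circle -` U))"
    using continuous_on_open_vimage[OF open_UNIV, of F] by auto
  also have "F -` (to_circle -` U) = to_circle -` (descend F -` U)"
    using assms by (auto simp: descend_to_circle)
  finally show "open (descend F -` U \<inter> UNIV)"
    by (simp add: open_circle_def)
qed

lemma PL_lift_circle_lift:
  assumes "F \<in> PL_lift"
  shows "circle_lift F (descend F)"
  using assms by (auto simp: circle_lift_def descend_to_circle PL_lift_def intro: PL_line_continuous)

text \<open>Periodicity reduces the locally finite breakpoints of the lift to those in one period,
  which are finitely many. The point 0 is added so that every breakpoint-free interval lies within
  one period.\<close>

lemma piecewise_linear_circle_descend:
  assumes "F \<in> PL_lift"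
  shows "piecewise_linear_circle (descend F)"
proof -
  obtain B where B: "\<And>a b. finite (B \<inter> {a..b})" and PL: "piecewise_linear UNIV B F"
    using assms by (auto simp: PL_lift_def PL_line_def)
  define B' where "B' = to_circle ` insert 0 (B \<inter> {0..1})"
  have "finite B'"
    using B by (simp add: B'_def)
  moreover have "piecewise_linear UNIV (to_circle -` B') F"
    unfolding piecewise_linear_def
  proof (intro allI impI, elim conjE)
    fix x y :: real
    assume "x < y" and disj: "{x<..<y} \<inter> to_circle -` B' = {}"
    define j where "j = \<lfloor>x\<rfloor>"
    have "of_int j \<le> x" "x < of_int j + 1"
      by (auto simp: j_def)
    have "y \<le> of_int j + 1"
    proof (rule ccontr)
      assume "\<not> y \<le> of_int j + 1"
      moreover have "to_circle (of_int j + 1) = to_circle 0"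
        by (simp add: to_circle_eq_iff)
      ultimately have "of_int j + 1 \<in> {x<..<y} \<inter> to_circle -` B'"
        using \<open>x < of_int j + 1\<close> by (simp add: B'_def)
      with disj show False by blast
    qed
    have "{x - of_int j<..<y - of_int j} \<inter> B = {}"
    proof (rule ccontr)
      assume "{x - of_int j<..<y - of_int j} \<inter> B \<noteq> {}"
      then obtain u where u: "u \<in> B" "u \<in> {x - of_int j<..<y - of_int j}" by blast
      then have "u \<in> B \<inter> {0..1}"
        using \<open>of_int j \<le> x\<close> \<open>y \<le> of_int j + 1\<close> by auto
      then have "to_circle (u + of_int j) \<in> B'"
        by (auto simp: B'_def)
      moreover have "u + of_int j \<in> {x<..<y}"
        using u by auto
      ultimately show False
        using disj by blast
    qed
    then obtain m c where mc: "\<And>t. t \<in> {x - of_int j..y - of_int j} \<Longrightarrow> F t = m * t + c"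
      using PL \<open>x < y\<close>
      by (elim piecewise_linearD[of UNIV B F "x - of_int j" "y - of_int j"]) auto
    show "\<exists>m c. \<forall>t\<in>{x..y}. F t = m * t + c"
    proof (intro exI ballI)
      fix t assume t: "t \<in> {x..y}"
      have "F ((t - of_int j) + of_int j) = F (t - of_int j) + of_int j"
        using assms unfolding PL_lift_def by blast
      also have "F (t - of_int j) = m * (t - of_int j) + c"
        using t by (intro mc) auto
      finally show "F t = m * t + (c - m * of_int j + of_int j)"
        by (simp add: algebra_simps)
    qed
  qed
  ultimately show ?thesis
    using PL_lift_circle_lift[OF assms] unfolding piecewise_linear_circle_def by blast
qed

lemma descend_in_Bij:
  assumes "F \<in> PL_lift"
  shows "descend F \<in> Bij UNIV"
  using descend_inverse[OF assms] by (auto simp: Bij_def intro!: o_bij[of "descend (inv_into UNIV F)"])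

lemma descend_in_PL_circle:
  assumes "F \<in> PL_lift"
  shows "descend F \<in> carrier PL_circle"
proof -
  have "homeomorphism UNIV UNIV (descend F) (descend (inv_into UNIV F))"
    using assms descend_inverse[OF assms]
    by (intro homeomorphismI) (auto simp: continuous_on_descend PL_lift_inverse)
  moreover have "orientation_preserving (descend F)"
    using assms PL_lift_circle_lift[OF assms]
    by (auto simp: orientation_preserving_def PL_lift_def PL_line_def)
  ultimately show ?thesis
    using descend_in_Bij[OF assms] piecewise_linear_circle_descend[OF assms]
    by (auto simp: PL_circle_def)
qed

section \<open>Interval maps on the circle\<close>

lemma PL_interval_group: "group PL_interval"
proof -
  let ?H = "carrier PL_interval"
  have H_iff: "f \<in> ?H \<longleftrightarrow> f \<in> Bij {0..1} \<and> (\<exists>g. homeomorphism {0..1} {0..1} f g) \<and>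
    strict_mono_on {0..1} f \<and> (\<exists>B. finite B \<and> piecewise_linear {0..1} B f)" for f
    by (auto simp: PL_interval_def)
  \<comment> \<open>Elements of \<open>Bij {0..1}\<close> are \<open>undefined\<close> off the
    interval, unlike plain composites and inverses. All other conditions see only values on the
    interval, so they pass between functions agreeing there.\<close>
  have transfer: "f' \<in> ?H"
    if "f' \<in> Bij {0..1}" "\<And>x. x \<in> {0..1} \<Longrightarrow> f' x = f x"
      "homeomorphism {0..1} {0..1} f g" "strict_mono_on {0..1} f"
      "finite B" "piecewise_linear {0..1} B f" for f f' g B
  proof -
    note PL = that(6) and f' = that(2)
    have "homeomorphism {0..1} {0..1} f' g"
      using that by (intro homeomorphism_cong[OF that(3)]) auto
    moreover have "strict_mono_on {0..1} f'"
      using that by (auto simp: strict_mono_on_def)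
    moreover have "piecewise_linear {0..1} B f'"
      unfolding piecewise_linear_def
    proof (intro allI impI, elim conjE)
      fix x y :: real assume xy: "x < y" "{x..y} \<subseteq> {0..1}" "{x<..<y} \<inter> B = {}"
      obtain m c where "\<And>t. t \<in> {x..y} \<Longrightarrow> f t = m * t + c"
        using piecewise_linearD[OF PL xy] by metis
      moreover have "f' t = f t" if "t \<in> {x..y}" for t
        using that xy f' by blast
      ultimately show "\<exists>m c. \<forall>t\<in>{x..y}. f' t = m * t + c"
        by (intro exI[of _ m] exI[of _ c]) simp
    qed
    ultimately show ?thesis
      unfolding H_iff using that by blast
  qed
  have "subgroup ?H (BijGroup {0..1})"
  proof (rule subgroup.intro)
    show "?H \<subseteq> carrier (BijGroup {0..1})"
      by (auto simp: H_iff BijGroup_def)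
  next
    fix x y assume x: "x \<in> ?H" and y: "y \<in> ?H"
    obtain g B where xg: "homeomorphism {0..1} {0..1} x g" "finite B" "piecewise_linear {0..1} B x"
      using x H_iff by blast
    obtain g' B' where yg: "homeomorphism {0..1} {0..1} y g'" "finite B'"
      "piecewise_linear {0..1} B' y"
      using y H_iff by blast
    have mono: "strict_mono_on {0..1} x" "strict_mono_on {0..1} y"
      and bij: "x \<in> Bij {0..1}" "y \<in> Bij {0..1}"
      using x y H_iff by auto
    have img: "y ` {0..1} = {0..1}"
      using yg by (simp add: homeomorphism_def)
    have "compose {0..1} x y \<in> ?H"
    proof (rule transfer)
      show "compose {0..1} x y \<in> Bij {0..1}"
        using bij by (rule compose_Bij)
      show "compose {0..1} x y t = (x \<circ> y) t" if "t \<in> {0..1}" for t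
        using that by (simp add: compose_def)
      show "homeomorphism {0..1} {0..1} (x \<circ> y) (g' \<circ> g)"
        using yg(1) xg(1) by (rule homeomorphism_compose)
      show "strict_mono_on {0..1} (x \<circ> y)"
      proof (rule strict_mono_onI)
        fix s t :: real assume st: "s \<in> {0..1}" "t \<in> {0..1}" "s < t"
        then have "y s < y t" "y s \<in> {0..1}" "y t \<in> {0..1}"
          using img strict_mono_onD[OF mono(2)] by blast+
        then show "(x \<circ> y) s < (x \<circ> y) t"
          using strict_mono_onD[OF mono(1)] by simp
      qed
      show "piecewise_linear {0..1} (B' \<union> {t \<in> {0..1}. y t \<in> B}) (x \<circ> y)"
        using xg yg mono img by (intro piecewise_linear_compose) auto
      have "inj_on y {0..1}"
        using bij by (auto simp: Bij_def bij_betw_def)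
      then have "finite (y -` B \<inter> {0..1})"
        using xg by (intro finite_vimage_IntI)
      then show "finite (B' \<union> {t \<in> {0..1}. y t \<in> B})"
        using yg by (simp add: vimage_def Int_def conj_commute)
    qed
    then show "x \<otimes>\<^bsub>BijGroup {0..1}\<^esub> y \<in> ?H"
      using bij by (simp add: BijGroup_def)
  next
    show "\<one>\<^bsub>BijGroup {0..1}\<^esub> \<in> ?H"
      unfolding BijGroup_def monoid.simps
      by (rule transfer[OF id_Bij _ homeomorphism_ident strict_mono_on_ident, of "{}"])
        (auto simp: piecewise_linear_ident)
  next
    fix x assume x: "x \<in> ?H"
    obtain g B where xg: "homeomorphism {0..1} {0..1} x g" "finite B" "piecewise_linear {0..1} B x"
      using x H_iff by blast
    have mono: "strict_mono_on {0..1} x" and bij: "x \<in> Bij {0..1}"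
      using x H_iff by auto
    have img: "x ` {0..1} = {0..1}" and inj: "inj_on x {0..1}"
      using bij by (auto simp: Bij_def bij_betw_def)
    have inv_eq: "inv_into {0..1} x t = g t" if "t \<in> {0..1}" for t
      using that xg(1) inj by (auto simp: homeomorphism_def intro!: inv_into_f_eq)
    have "(\<lambda>t\<in>{0..1}. inv_into {0..1} x t) \<in> ?H"
    proof (rule transfer)
      show "(\<lambda>t\<in>{0..1}. inv_into {0..1} x t) \<in> Bij {0..1}"
        using bij by (rule restrict_inv_into_Bij)
      show "(\<lambda>t\<in>{0..1}. inv_into {0..1} x t) t = g t" if "t \<in> {0..1}" for t
        using that inv_eq by simp
      show "homeomorphism {0..1} {0..1} g x"
        using xg(1) by (rule homeomorphism_sym[THEN iffD1])
      show "strict_mono_on {0..1} g"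
      proof (rule strict_mono_onI)
        fix s t :: real assume st: "s \<in> {0..1}" "t \<in> {0..1}" "s < t"
        then have "g s \<in> {0..1}" "g t \<in> {0..1}" "x (g s) < x (g t)"
          using xg(1) by (auto simp: homeomorphism_def)
        then show "g s < g t"
          using strict_mono_on_less[OF mono] by blast
      qed
      show "finite (x ` (B \<inter> {0..1}))"
        using xg by simp
      show "piecewise_linear {0..1} (x ` (B \<inter> {0..1})) g"
        using xg mono img by (intro piecewise_linear_inverse) (auto simp: homeomorphism_def)
    qed
    then show "inv\<^bsub>BijGroup {0..1}\<^esub> x \<in> ?H"
      using bij by (simp add: inv_BijGroup)
  qed
  then have "group (BijGroup {0..1} \<lparr>carrier := ?H\<rparr>)"
    by (rule subgroup.subgroup_is_group[OF _ group_BijGroup])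
  then show ?thesis
    by (simp add: PL_interval_def)
qed

lemma PL_intervalD:
  assumes "f \<in> carrier PL_interval"
  shows "f \<in> Bij {0..1}" "strict_mono_on {0..1} f" "f ` {0..1} = {0..1}"
    "\<exists>B. finite B \<and> piecewise_linear {0..1} B f"
  using assms by (auto simp: PL_interval_def Bij_def bij_betw_def)

lemma bump_PL_lift:
  assumes "f \<in> carrier PL_interval"
  shows "bump 1 f \<in> PL_lift"
  using PL_intervalD[OF assms] bump_add_int[of 1] by (auto simp: PL_lift_def intro: bump_PL_line)

definition half_circle_map :: "(real \<Rightarrow> real) \<Rightarrow> circle \<Rightarrow> circle" where
  "half_circle_map f = descend (bump 1 f)"

lemma half_circle_map_to_circle:
  assumes "f \<in> carrier PL_interval"
  shows "half_circle_map f (to_circle x) = to_circle (bump 1 f x)"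
  unfolding half_circle_map_def by (rule descend_to_circle[OF bump_PL_lift[OF assms]])

lemma half_circle_map_left:
  assumes "f \<in> carrier PL_interval" "u \<in> {0..1/2}"
  shows "half_circle_map f (to_circle u) = to_circle (f (2 * u) / 2)"
  unfolding half_circle_map_to_circle[OF assms(1)]
  by (simp only: bump_left[OF order_refl PL_intervalD(2,3)[OF assms(1)] assms(2)])

lemma half_circle_map_right:
  assumes "f \<in> carrier PL_interval" "u \<in> {1/2..1}"
  shows "half_circle_map f (to_circle u) = to_circle u"
  unfolding half_circle_map_to_circle[OF assms(1)]
  by (simp only: bump_right[OF PL_intervalD(2,3)[OF assms(1)] assms(2)])

text \<open>Both half circles are preserved: on the first the maps are half-scale copies of
  \<open>f\<close> and \<open>g\<close>, on the second they are trivial.\<close>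

lemma half_circle_map_mult:
  assumes "f \<in> carrier PL_interval" "g \<in> carrier PL_interval"
  shows "half_circle_map (f \<otimes>\<^bsub>PL_interval\<^esub> g) = half_circle_map f \<circ> half_circle_map g"
proof
  fix c
  have fg: "f \<otimes>\<^bsub>PL_interval\<^esub> g = compose {0..1} f g"
    using PL_intervalD(1)[OF assms(1)] PL_intervalD(1)[OF assms(2)]
    by (simp add: PL_interval_def BijGroup_def)
  have fg_in: "f \<otimes>\<^bsub>PL_interval\<^esub> g \<in> carrier PL_interval"
    using PL_interval_group assms by (simp add: group.is_monoid monoid.m_closed)
  obtain u where u: "0 \<le> u" "u < 1" "c = to_circle u"
    by (rule to_circle_cases)
  show "half_circle_map (f \<otimes>\<^bsub>PL_interval\<^esub> g) c = (half_circle_map f \<circ> half_circle_map g) c"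
  proof (cases "u \<le> 1/2")
    case True
    then have "g (2 * u) \<in> g ` {0..1}"
      using u by (intro imageI) auto
    then have "g (2 * u) / 2 \<in> {0..1/2}"
      using PL_intervalD(3)[OF assms(2)] by auto
    with True u show ?thesis
      using assms fg_in by (simp add: half_circle_map_left) (simp add: fg compose_def)
  next
    case False
    with u show ?thesis
      using assms fg_in by (simp add: half_circle_map_right)
  qed
qed

lemma half_circle_map_one: "half_circle_map \<one>\<^bsub>PL_interval\<^esub> = id"
proof
  fix c
  have one: "\<one>\<^bsub>PL_interval\<^esub> = (\<lambda>x\<in>{0..1}. x)"
    by (simp add: PL_interval_def BijGroup_def)
  have one_in: "\<one>\<^bsub>PL_interval\<^esub> \<in> carrier PL_interval"
    using PL_interval_group by (simp add: group.is_monoid monoid.one_closed)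
  obtain u where u: "0 \<le> u" "u < 1" "c = to_circle u"
    by (rule to_circle_cases)
  then show "half_circle_map \<one>\<^bsub>PL_interval\<^esub> c = id c"
    using one_in by (cases "u \<le> 1/2") (simp_all add: half_circle_map_left half_circle_map_right, simp add: one)
qed

lemma half_circle_map_inj: "inj_on half_circle_map (carrier PL_interval)"
proof (rule inj_onI)
  fix f g assume fg: "f \<in> carrier PL_interval" "g \<in> carrier PL_interval"
    and eq: "half_circle_map f = half_circle_map g"
  show "f = g"
  proof (rule extensionalityI)
    show "f \<in> extensional {0..1}" "g \<in> extensional {0..1}"
      using fg PL_intervalD(1) by (auto simp: Bij_def)
  next
    fix x :: real assume x: "x \<in> {0..1}"
    then have "to_circle (f x / 2) = to_circle (g x / 2)"
      using half_circle_map_left[of f "x / 2"] half_circle_map_left[of g "x / 2"] fg eq by simp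
    then obtain k where k: "f x / 2 = g x / 2 + of_int k"
      by (rule to_circle_eqE)
    \<comment> \<open>Half-scale values lie in [0, 1/2], too short an interval for distinct points
      to be identified on the circle.\<close>
    have "f x \<in> {0..1}" "g x \<in> {0..1}"
      using x fg PL_intervalD(3) by blast+
    with k have "\<bar>real_of_int k\<bar> < 1" by auto
    then have "k = 0" by linarith
    with k show "f x = g x" by simp
  qed
qed

text \<open>The open half interval suffices as support because \<open>f\<close> fixes 0 and the
  remaining arc, starting at 1/2, is fixed pointwise.\<close>

lemma half_circle_map_support:
  assumes "f \<in> carrier PL_interval" "c \<notin> to_circle ` {0<..<1/2}"
  shows "half_circle_map f c = c"
proof -
  obtain u where u: "0 \<le> u" "u < 1" "c = to_circle u"
    by (rule to_circle_cases)
  with assms(2) have "u = 0 \<or> u \<ge> 1/2"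
    by force
  moreover have "f 0 = 0"
    using endpoints_fixed(1)[OF PL_intervalD(2,3)[OF assms(1)]] by simp
  ultimately show ?thesis
    using u assms half_circle_map_left[of f 0] half_circle_map_right[of f u] by auto
qed

section \<open>Cosets of the integers\<close>

abbreviation rat_add_group :: "rat monoid" where
  "rat_add_group \<equiv> \<lparr>carrier = UNIV, monoid.mult = (+), one = 0\<rparr>"

lemma normal_Ints: "\<int> \<lhd> rat_add_group"
proof -
  interpret comm_group rat_add_group
  proof (rule comm_groupI)
    fix x :: rat
    show "\<exists>y\<in>carrier rat_add_group. y \<otimes>\<^bsub>rat_add_group\<^esub> x = \<one>\<^bsub>rat_add_group\<^esub>"
      by (auto intro: exI[of _ "- x"])
  qed auto
  have "subgroup \<int> rat_add_group"
  proof (rule subgroupI)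
    fix x :: rat assume "x \<in> \<int>"
    moreover have "inv\<^bsub>rat_add_group\<^esub> x = - x"
      by (rule inv_equality) auto
    ultimately show "inv\<^bsub>rat_add_group\<^esub> x \<in> \<int>"
      by simp
  qed auto
  then show ?thesis
    by (simp add: normal_iff_subgroup)
qed

lemma rat_mod_int_group: "group rat_mod_int"
  unfolding rat_mod_int_def by (rule normal.factorgroup_is_group[OF normal_Ints])

lemma carrier_rat_mod_int: "carrier rat_mod_int = range (\<lambda>q. (\<lambda>z. z + q) ` \<int>)"
  by (auto simp: rat_mod_int_def FactGroup_def RCOSETS_def r_coset_def)

definition coset_action :: "rat set \<Rightarrow> circle \<Rightarrow> circle" where
  "coset_action k = descend (rat_action (SOME q. q \<in> k))"

text \<open>Integer translations are themselves values of \<open>rat_action\<close>, so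
  commutativity of the rationals makes every \<open>rat_action q\<close> commute with them.\<close>

lemma rat_action_PL_lift: "rat_action q \<in> PL_lift"
proof -
  have "rat_action q (x + of_int k) = rat_action q x + of_int k" for x k
  proof -
    have "rat_action q (x + of_int k) = rat_action (q + of_int k) x"
      by (simp add: rat_action_add rat_action_of_int)
    also have "\<dots> = rat_action (of_int k + q) x"
      by (simp add: add.commute)
    also have "\<dots> = rat_action q x + of_int k"
      by (simp add: rat_action_add rat_action_of_int)
    finally show ?thesis .
  qed
  then show ?thesis
    by (simp add: PL_lift_def rat_action_PL_line)
qed

text \<open>Two representatives differ by an integer, which acts as an integer translation and hence
  trivially on the circle.\<close>

lemma coset_action_eq:
  assumes "k \<in> carrier rat_mod_int" "q \<in> k"
  shows "coset_action k = descend (rat_action q)"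
proof -
  define r where "r = (SOME q. q \<in> k)"
  have "r \<in> k"
    using assms(2) unfolding r_def by (rule someI)
  with assms have "r - q \<in> \<int>"
    by (auto simp: carrier_rat_mod_int)
  then obtain n where "r = of_int n + q"
    by (metis Ints_cases diff_add_cancel)
  then have "descend (rat_action r) = descend (rat_action q)"
    by (auto simp: descend_def rat_action_add rat_action_of_int)
  then show ?thesis
    by (simp add: coset_action_def r_def)
qed

lemma coset_nonempty:
  assumes "k \<in> carrier rat_mod_int"
  obtains q where "q \<in> k"
  using assms by (auto simp: carrier_rat_mod_int)

lemma coset_action_mult:
  assumes "k \<in> carrier rat_mod_int" "l \<in> carrier rat_mod_int"
  shows "coset_action (k \<otimes>\<^bsub>rat_mod_int\<^esub> l) = coset_action k \<circ> coset_action l"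
proof -
  obtain q r where qr: "q \<in> k" "r \<in> l"
    using assms coset_nonempty by metis
  then have "q + r \<in> k \<otimes>\<^bsub>rat_mod_int\<^esub> l"
    by (auto simp: rat_mod_int_def set_mult_def)
  moreover have "k \<otimes>\<^bsub>rat_mod_int\<^esub> l \<in> carrier rat_mod_int"
    using assms rat_mod_int_group by (simp add: group.is_monoid monoid.m_closed)
  ultimately have "coset_action (k \<otimes>\<^bsub>rat_mod_int\<^esub> l) = descend (rat_action (q + r))"
    by (intro coset_action_eq)
  also have "\<dots> = descend (rat_action q) \<circ> descend (rat_action r)"
    by (simp only: rat_action_add descend_compose rat_action_PL_lift)
  finally show ?thesis
    using assms qr by (simp add: coset_action_eq)
qed

lemma one_rat_mod_int: "\<one>\<^bsub>rat_mod_int\<^esub> = \<int>"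
  by (simp add: rat_mod_int_def)

lemma coset_action_one: "coset_action \<one>\<^bsub>rat_mod_int\<^esub> = id"
proof -
  have "coset_action \<one>\<^bsub>rat_mod_int\<^esub> = descend (rat_action (of_int 0))"
    using rat_mod_int_group
    by (intro coset_action_eq) (auto simp: one_rat_mod_int[symmetric] group.is_monoid monoid.one_closed, simp add: one_rat_mod_int)
  also have "\<dots> = id"
    unfolding descend_def rat_action_of_int by (auto simp: to_circle_rep)
  finally show ?thesis .
qed

lemma coset_action_wandering:
  assumes k: "k \<in> carrier rat_mod_int" and "c \<in> to_circle ` {0<..<1/2}"
    and "coset_action k c \<in> to_circle ` {0<..<1/2}"
  shows "k = \<one>\<^bsub>rat_mod_int\<^esub>"
proof -
  obtain q where q: "q \<in> k"
    using k by (rule coset_nonempty)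
  obtain x y where x: "x \<in> {0<..<1/2}" "c = to_circle x"
    and y: "y \<in> {0<..<1/2}" "coset_action k c = to_circle y"
    using assms by blast
  have "to_circle (rat_action q x) = to_circle y"
    using x y k q by (simp add: coset_action_eq descend_to_circle rat_action_PL_lift)
  then obtain n where n: "rat_action q x = y + of_int n"
    by (rule to_circle_eqE)
  \<comment> \<open>On the circle the points meet only modulo an integer \<open>n\<close>; absorbing
    it into the representative reduces the claim to wandering on the line.\<close>
  have "rat_action (of_int (- n) + q) x = y"
    unfolding rat_action_add comp_def rat_action_of_int n by simp
  then have "of_int (- n) + q = 0"
    using x y by (intro rat_action_wandering[of x]) auto
  then have "q \<in> \<int>"
    by simp
  obtain p where p: "k = (\<lambda>z. z + p) ` \<int>"
    using k by (auto simp: carrier_rat_mod_int)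
  with q obtain z where "z \<in> \<int>" "q = z + p"
    by blast
  then have "q - z \<in> \<int>" "q - z = p"
    using \<open>q \<in> \<int>\<close> by simp_all
  then have "p \<in> \<int>"
    by simp
  have "k = \<int>"
  proof
    show "k \<subseteq> \<int>"
      using p \<open>p \<in> \<int>\<close> by auto
    show "\<int> \<subseteq> k"
    proof
      fix w :: rat assume "w \<in> \<int>"
      then show "w \<in> k"
        unfolding p using \<open>p \<in> \<int>\<close> by (intro image_eqI[of _ _ "w - p"]) auto
    qed
  qed
  then show ?thesis
    by (simp add: one_rat_mod_int)
qed

section \<open>Assembling the embedding\<close>

lemma PL_lift_image_compose:
  assumes "f \<in> descend ` PL_lift" "g \<in> descend ` PL_lift"
  shows "f \<circ> g \<in> descend ` PL_lift"
proof -
  obtain F G where FG: "F \<in> PL_lift" "G \<in> PL_lift" and fg: "f = descend F" "g = descend G"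
    using assms by blast
  have "f \<circ> g = descend (F \<circ> G)"
    unfolding fg by (rule descend_compose[OF FG(2,1), symmetric])
  then show ?thesis
    using PL_lift_compose[OF FG(2,1)] by (rule image_eqI)
qed

lemma PL_lift_image_subset:
  "descend ` PL_lift \<subseteq> carrier PL_circle" "descend ` PL_lift \<subseteq> Bij UNIV"
  by (simp_all add: image_subset_iff descend_in_PL_circle descend_in_Bij)

lemma PL_circle_mult:
  assumes "f \<in> Bij UNIV" "g \<in> Bij UNIV"
  shows "f \<otimes>\<^bsub>PL_circle\<^esub> g = f \<circ> g"
  using assms by (simp add: PL_circle_def BijGroup_def compose_def fun_eq_iff)

lemma PL_wreath_action:
  assumes "subgroup K rat_mod_int"
  shows "wreath_action PL_interval (rat_mod_int\<lparr>carrier := K\<rparr>) half_circle_map coset_action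
    (to_circle ` {0<..<1/2})" (is "wreath_action _ ?T _ _ _")
proof -
  have K: "k \<in> carrier rat_mod_int" if "k \<in> K" for k
    using assms that by (rule subgroup.mem_carrier)
  show ?thesis
  proof (rule wreath_action.intro)
    show "group PL_interval"
      by (rule PL_interval_group)
    show "group ?T"
      using assms rat_mod_int_group by (rule subgroup.subgroup_is_group)
    show "to_circle ` {0<..<1/2} \<noteq> {}"
      by auto
  next
    fix f g assume "f \<in> carrier PL_interval" "g \<in> carrier PL_interval"
    then show "half_circle_map (f \<otimes>\<^bsub>PL_interval\<^esub> g) = half_circle_map f \<circ> half_circle_map g"
      by (rule half_circle_map_mult)
  next
    fix f c assume "f \<in> carrier PL_interval" "c \<notin> to_circle ` {0<..<1/2}"
    then show "half_circle_map f c = c"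
      by (rule half_circle_map_support)
  next
    fix k l assume "k \<in> carrier ?T" "l \<in> carrier ?T"
    then show "coset_action (k \<otimes>\<^bsub>?T\<^esub> l) = coset_action k \<circ> coset_action l"
      by (simp add: coset_action_mult K)
  next
    fix k c assume k: "k \<in> carrier ?T" and c: "c \<in> to_circle ` {0<..<1/2}"
      "coset_action k c \<in> to_circle ` {0<..<1/2}"
    have "k \<in> carrier rat_mod_int"
      using k by (simp add: K)
    then have "k = \<one>\<^bsub>rat_mod_int\<^esub>"
      using c by (rule coset_action_wandering)
    then show "k = \<one>\<^bsub>?T\<^esub>"
      by simp
  next
    show "coset_action \<one>\<^bsub>?T\<^esub> = id"
      by (simp add: coset_action_one)
  qed (rule half_circle_map_one half_circle_map_inj)+
qed

theorem theorem1p7: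
  fixes K :: "rat set set"
  assumes "subgroup K rat_mod_int"
  shows "\<exists>h. h \<in> mon (restricted_wreath_product PL_interval (rat_mod_int\<lparr>carrier := K\<rparr>)) PL_circle"
proof -
  let ?T = "rat_mod_int\<lparr>carrier := K\<rparr>"
  let ?W = "restricted_wreath_product PL_interval ?T"
  interpret wreath_action PL_interval ?T half_circle_map coset_action "to_circle ` {0<..<1/2}"
    using assms by (rule PL_wreath_action)
  \<comment> \<open>The class of maps used is the image of \<open>PL_lift\<close> under
    \<open>descend\<close>: closure under composition is immediate there, since explicit lifts can
    be composed, and it lies inside the carrier of \<open>PL_circle\<close>.\<close>
  have P: "wreath_action x \<in> descend ` PL_lift" if "x \<in> carrier ?W" for x
  proof (rule wreath_action_in_closed_set[OF PL_lift_image_compose _ _ that])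
    show "coset_action t \<in> descend ` PL_lift" for t
      unfolding coset_action_def by (intro imageI rat_action_PL_lift)
    show "half_circle_map c \<in> descend ` PL_lift" if "c \<in> carrier PL_interval" for c
      unfolding half_circle_map_def using that by (intro imageI bump_PL_lift)
  qed
  have "wreath_action \<in> hom ?W PL_circle"
  proof (rule homI)
    fix x assume "x \<in> carrier ?W"
    then show "wreath_action x \<in> carrier PL_circle"
      by (rule subsetD[OF PL_lift_image_subset(1) P])
  next
    fix x y assume xy: "x \<in> carrier ?W" "y \<in> carrier ?W"
    then have "wreath_action x \<in> Bij UNIV" "wreath_action y \<in> Bij UNIV"
      by (auto intro: subsetD[OF PL_lift_image_subset(2) P])
    then show "wreath_action (x \<otimes>\<^bsub>?W\<^esub> y) = wreath_action x \<otimes>\<^bsub>PL_circle\<^esub> wreath_action y"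
      unfolding wreath_action_mult[OF xy] by (rule PL_circle_mult[symmetric])
  qed
  with wreath_action_inj show ?thesis
    unfolding mon_def by blast
qed

end
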